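(* There is a random variable $Z_*$ such that $\hat Z_N \overset{d}{\to} Z_*$ as $N\to\infty$. If $\Lambda$ denotes the distribution function of $Z_*$, then the cumulants $\kappa_n^*=\kappa_n(Z_* )$, $n=1,2,\ldots$, of $\Lambda$ are given by \[ \kappa_{2n-1}^{*}=\lim_{N\to\infty}\kappa_{2n-1}(\hat Z_N)=0,\qquad \kappa_{2n}^{*}=\lim_{N\to\infty}\kappa_{2n}(\hat Z_N)=\frac{B_{2n}}{2n}\,\frac{6^{2n}}{2^{2n}-1},\qquad n=1,2,\ldots \] In particular, the limit distribution $\Lambda$ is not Gaussian.
   Context: For each integer $N\ge 1$, let $\Omega_N$ be the set of all $\omega=(k_1,\ldots,k_N)$ of integers with $0\le k_j\le 2^j-1$, $j=1,\ldots,N$, equipped with the uniform probability ${\bf P}(\omega)=2^{-N(N+1)/2}$, and let $Z_N(\omega)=k_1+\cdots+k_N$. Let $\mu_N={\bf E}Z_N$, $\sigma_N^2={\bf Var}\,Z_N$ (with $\sigma_N>0$), and $\hat Z_N=(Z_N-\mu_N)/\sigma_N$. The cumulants $\kappa_j(\xi)$ of a random variable $\xi$ whose moment generating function is finite near $0$ are defined by $\log {\bf E}e^{t\xi}=\sum_{j\ge1}\kappa_j(\xi)\,t^j/j!$ for $t$ near $0$. The Bernoulli numbers $B_n$ are defined by $\sum_{n=0}^\infty B_n t^n/n!=t/(e^t-1)$. The symbol $\overset{d}{\to}$ denotes convergence in distribution. *)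

theory Defs
  imports "HOL-Probability.Probability"
begin

(* A tuple (k_1, ..., k_N) is an extensional function on {1..N} (PiE fixes the value
   undefined outside the index set), so there are 2^1 * ... * 2^N outcomes. *)
definition Omega :: "nat \<Rightarrow> (nat \<Rightarrow> int) set" where
  "Omega N = PiE {1..N} (\<lambda>j. {0 .. 2 ^ j - 1})"

definition P :: "nat \<Rightarrow> (nat \<Rightarrow> int) pmf" where
  "P N = pmf_of_set (Omega N)"

lemma finite_Omega: "finite (Omega N)"
  unfolding Omega_def by (intro finite_PiE) auto

lemma Omega_nonempty: "Omega N \<noteq> {}"
  unfolding Omega_def by (auto simp: PiE_eq_empty_iff)

lemma card_Omega: "card (Omega N) = 2 ^ (N * (N + 1) div 2)"
proof -
  have "card (Omega N) = (\<Prod>j = 1..N. 2 ^ j)"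
    unfolding Omega_def by (simp add: card_PiE nat_power_eq)
  also have "\<dots> = 2 ^ (\<Sum>j = 1..N. j)"
    by (rule power_sum [symmetric])
  also have "(\<Sum>j = 1..N. j) = N * (N + 1) div 2"
    by (induction N) auto
  finally show ?thesis .
qed

lemma pmf_P: "\<omega> \<in> Omega N \<Longrightarrow> pmf (P N) \<omega> = 1 / 2 ^ (N * (N + 1) div 2)"
  by (simp add: P_def finite_Omega Omega_nonempty card_Omega)

definition Z :: "nat \<Rightarrow> (nat \<Rightarrow> int) \<Rightarrow> real" where
  "Z N \<omega> = of_int (\<Sum>j = 1..N. \<omega> j)"

definition mu :: "nat \<Rightarrow> real" where
  "mu N = measure_pmf.expectation (P N) (Z N)"

definition sigma :: "nat \<Rightarrow> real" where
  "sigma N = sqrt (measure_pmf.variance (P N) (Z N))"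

(* For N = 0 the variance vanishes and this is the constant 0; only N >= 1 matters. *)
definition Zhat :: "nat \<Rightarrow> (nat \<Rightarrow> int) \<Rightarrow> real" where
  "Zhat N \<omega> = (Z N \<omega> - mu N) / sigma N"

definition mgf_finite_near_0 :: "'a measure \<Rightarrow> ('a \<Rightarrow> real) \<Rightarrow> bool" where
  "mgf_finite_near_0 M X \<longleftrightarrow> (\<forall>\<^sub>F t in nhds 0. integrable M (\<lambda>x. exp (t * X x)))"

(* The constant term of the expansion is ln 1 = 0 for a probability measure M,
   so the series effectively starts at j = 1. *)
definition has_cumulants :: "'a measure \<Rightarrow> ('a \<Rightarrow> real) \<Rightarrow> (nat \<Rightarrow> real) \<Rightarrow> bool" where
  "has_cumulants M X \<kappa> \<longleftrightarrow> mgf_finite_near_0 M X \<and>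
     (\<lambda>t. ln (\<integral>x. exp (t * X x) \<partial>M)) has_fps_expansion Abs_fps (\<lambda>j. \<kappa> j / fact j)"

definition cumulant :: "'a measure \<Rightarrow> ('a \<Rightarrow> real) \<Rightarrow> nat \<Rightarrow> real" where
  "cumulant M X = (THE \<kappa>. has_cumulants M X \<kappa>)"

lemma zero_has_fps_expansion_real:
  assumes "((\<lambda>_. 0) :: real \<Rightarrow> real) has_fps_expansion F"
  shows "F = 0"
proof (rule ccontr)
  assume "F \<noteq> 0"
  define G where "G = fps_shift (subdegree F) F"
  have G: "(\<lambda>x::real. if x = 0 then fps_nth F (subdegree F) else 0 / x ^ subdegree F) has_fps_expansion G"
    unfolding G_def by (rule has_fps_expansion_shift [OF assms]) simp_all
  from has_fps_expansion_imp_continuous [OF this, of UNIV]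
  have "((\<lambda>x::real. if x = 0 then fps_nth F (subdegree F) else 0) \<longlongrightarrow> fps_nth F (subdegree F)) (at 0)"
    by (simp add: continuous_within cong: if_cong)
  moreover have "((\<lambda>x::real. if x = 0 then fps_nth F (subdegree F) else 0) \<longlongrightarrow> 0) (at 0)"
    by (rule tendsto_eventually) (simp add: eventually_at_filter)
  ultimately have "fps_nth F (subdegree F) = 0"
    using tendsto_unique trivial_limit_at by blast
  with \<open>F \<noteq> 0\<close> show False by simp
qed

lemma has_cumulants_unique:
  assumes "has_cumulants M X \<kappa>" "has_cumulants M X \<kappa>'"
  shows "\<kappa> = \<kappa>'"
proof -
  have "Abs_fps (\<lambda>j. \<kappa> j / fact j) - Abs_fps (\<lambda>j. \<kappa>' j / fact j) = 0"
    using assms unfolding has_cumulants_def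
    by (intro zero_has_fps_expansion_real) (use has_fps_expansion_diff in fastforce)
  then show ?thesis by (auto simp: fps_eq_iff fun_eq_iff)
qed

lemma cumulant_eq: "has_cumulants M X \<kappa> \<Longrightarrow> cumulant M X = \<kappa>"
  unfolding cumulant_def by (blast intro: the_equality has_cumulants_unique)

(* The generating function t / (e^t - 1), read as a quotient of formal power series. *)
definition bernoulli :: "nat \<Rightarrow> real" where
  "bernoulli n = fact n * fps_nth (fps_X / (fps_exp 1 - 1)) n"

lemma bernoulli_generating_function:
  "Abs_fps (\<lambda>n. bernoulli n / fact n) * (fps_exp 1 - 1) = fps_X"
proof -
  have nz: "fps_nth (fps_exp 1 - 1 :: real fps) 1 \<noteq> 0" by simp
  then have "fps_exp 1 - 1 \<noteq> (0 :: real fps)" by force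
  moreover from nz have "subdegree (fps_exp 1 - 1 :: real fps) \<le> subdegree (fps_X :: real fps)"
    using subdegree_leI [OF nz] by simp
  ultimately have "(fps_exp 1 - 1 :: real fps) dvd fps_X"
    by (simp add: fps_dvd_iff)
  moreover have "Abs_fps (\<lambda>n. bernoulli n / fact n) = fps_X / (fps_exp 1 - 1)"
    by (simp add: fps_eq_iff bernoulli_def)
  ultimately show ?thesis by simp
qed

end

theory Submission
  imports Defs
begin

text \<open>
The coordinate \<open>k\<^sub>j\<close>, uniform on \<open>{0..2 ^ j - 1}\<close> and centred, has moment generating function
\<open>sinhc (2 ^ j * t) / sinhc t\<close> with \<open>sinhc x = sinh (x/2) / (x/2)\<close>, and
\<open>ln (sinhc x) = (\<Sum>n\<ge>2. B\<^sub>n / (n * n!) * x ^ n)\<close> near \<open>0\<close>. By independence the cumulant of order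
\<open>n \<ge> 2\<close> of the sum is \<open>B\<^sub>n / n\<close> times \<open>(\<Sum>j = 1..N. 2 ^ (j * n) - 1)\<close>. This is a geometric sum,
asymptotic to \<open>2 ^ n / (2 ^ n - 1) * 2 ^ (N * n)\<close>; for \<open>n = 2\<close> it shows that the standard
deviation is asymptotic to \<open>2 ^ N / 3\<close>. Dividing by its \<open>n\<close>-th power leaves
\<open>B\<^sub>n / n * 6 ^ n / (2 ^ n - 1)\<close> in the limit, which is \<open>0\<close> for odd \<open>n\<close> because \<open>sinhc\<close> is even.

The last coordinates dominate the sum, so that the normalised variables are uniformly bounded
(\<open>Zhat_bound\<close>). This makes the passage from cumulants to distributions elementary. The logarithms
of the moment generating functions have a common disc of convergence and converge there, by
dominated convergence of their series (\<open>mgf_Zhat_tendsto\<close>). For uniformly bounded variables,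
convergence of the moment generating functions near \<open>0\<close> yields a weak limit with the limiting
moment generating function (\<open>bounded_weak_limit_if_mgf_converges\<close>): compactness provides limits of
subsequences, and a bounded distribution is determined by its moments. The cumulants of the limit
are then read off from the limiting series, and the limit is not Gaussian because it lives
on a bounded interval.
\<close>

section \<open>Bounded random variables and their moment generating functions\<close>

text \<open>
Boundedness makes the exponential series dominated, so expectation and sum can be exchanged.
The scalar \<open>z\<close> is polymorphic because the real instance is the moment generating function
and the imaginary one the characteristic function: both are read off from the same moments.
\<close>

lemma exp_moment_sums:
  fixes z :: "'b :: {real_normed_field, banach, second_countable_topology}" and X :: "'a \<Rightarrow> real"
  assumes "prob_space M" and [measurable]: "X \<in> borel_measurable M" and bound: "AE x in M. \<bar>X x\<bar> \<le> C"
  shows "(\<lambda>k. of_real ((\<integral>x. X x ^ k \<partial>M) / fact k) * z ^ k) sums (\<integral>x. exp (z * of_real (X x)) \<partial>M)"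
    and "integrable M (\<lambda>x. exp (z * of_real (X x)))"
proof -
  interpret prob_space M by fact
  define f where "f = (\<lambda>k x. (z * of_real (X x)) ^ k /\<^sub>R fact k)"
  have bd: "AE x in M. norm (f k x) \<le> (norm z * C) ^ k / fact k" for k
    using bound
  proof eventually_elim
    case (elim x)
    have "norm (f k x) = (norm z * \<bar>X x\<bar>) ^ k / fact k"
      by (simp add: f_def norm_power norm_mult divide_inverse)
    also have "\<dots> \<le> (norm z * C) ^ k / fact k"
      by (intro divide_right_mono power_mono mult_left_mono elim) auto
    finally show ?case .
  qed
  have int: "integrable M (f k)" for k
    using bd[of k] by (rule integrable_const_bound) (simp add: f_def)
  have exp_f: "exp (z * of_real (X x)) = (\<Sum>k. f k x)" for x
    by (simp add: exp_def f_def)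
  have summ: "summable (\<lambda>k. \<integral>x. norm (f k x) \<partial>M)"
  proof (rule summable_comparison_test')
    show "summable (\<lambda>k. (norm z * C) ^ k / fact k)"
      using summable_exp[of "norm z * C"] by (simp add: divide_inverse mult.commute)
    show "norm (\<integral>x. norm (f k x) \<partial>M) \<le> (norm z * C) ^ k / fact k" if "0 \<le> k" for k
    proof -
      have "(\<integral>x. norm (f k x) \<partial>M) \<le> (\<integral>x. (norm z * C) ^ k / fact k \<partial>M)"
        by (intro integral_mono_AE int integrable_norm bd integrable_const)
      then show ?thesis by (simp add: prob_space)
    qed
  qed
  have summ': "summable (\<lambda>k. norm (f k x))" for x
    unfolding f_def by (rule summable_norm_exp)
  have "(\<lambda>k. integral\<^sup>L M (f k)) sums (\<integral>x. (\<Sum>k. f k x) \<partial>M)"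
    by (rule sums_integral[OF int AE_I2[OF summ'] summ])
  moreover have "integral\<^sup>L M (f k) = of_real ((\<integral>x. X x ^ k \<partial>M) / fact k) * z ^ k" for k
  proof -
    have "AE x in M. norm (X x ^ k / fact k) \<le> C ^ k / fact k"
      using bound by eventually_elim (simp add: power_abs divide_right_mono power_mono)
    then have "integrable M (\<lambda>x. X x ^ k / fact k)"
      by (rule integrable_const_bound) simp
    moreover have "f k = (\<lambda>x. (X x ^ k / fact k) *\<^sub>R z ^ k)"
      by (simp add: f_def fun_eq_iff power_mult_distrib scaleR_conv_of_real divide_inverse mult_ac)
    ultimately show ?thesis by (simp only: integral_scaleR_left integral_divide_zero) (simp only: scaleR_conv_of_real)
  qed
  ultimately show "(\<lambda>k. of_real ((\<integral>x. X x ^ k \<partial>M) / fact k) * z ^ k) sums (\<integral>x. exp (z * of_real (X x)) \<partial>M)"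
    by (simp add: exp_f)
  show "integrable M (\<lambda>x. exp (z * of_real (X x)))"
    unfolding exp_f
    by (rule integrable_suminf[OF int AE_I2[OF summ'] summ])
qed

lemma has_fps_expansionI_real:
  fixes f :: "real \<Rightarrow> real"
  assumes "r > 0" and sums: "\<And>t. \<bar>t\<bar> < r \<Longrightarrow> (\<lambda>n. a n * t ^ n) sums f t"
  shows "f has_fps_expansion Abs_fps a"
  unfolding has_fps_expansion_def
proof
  have "ereal (norm (r / 2)) \<le> conv_radius a"
    using sums[of "r / 2"] \<open>r > 0\<close> by (intro conv_radius_geI) (auto simp: sums_iff)
  moreover have "0 < ereal (norm (r / 2))" using \<open>r > 0\<close> by simp
  ultimately show "fps_conv_radius (Abs_fps a) > 0"
    unfolding fps_conv_radius_def fps_nth_Abs_fps by (rule less_le_trans[rotated])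
  have "\<forall>\<^sub>F t in nhds 0. t \<in> ball 0 r"
    using \<open>r > 0\<close> by (intro eventually_nhds_in_open) auto
  then show "\<forall>\<^sub>F t in nhds 0. eval_fps (Abs_fps a) t = f t"
    by eventually_elim (use sums in \<open>auto simp: eval_fps_def sums_iff\<close>)
qed

lemma has_fps_expansion_unique_real:
  fixes f :: "real \<Rightarrow> real"
  assumes "f has_fps_expansion F" "f has_fps_expansion G"
  shows "F = G"
  using zero_has_fps_expansion_real[of "F - G"] has_fps_expansion_diff[OF assms] by simp

lemma mgf_has_fps_expansion:
  fixes X :: "'a \<Rightarrow> real"
  assumes "prob_space M" "X \<in> borel_measurable M" "AE x in M. \<bar>X x\<bar> \<le> C"
  shows "(\<lambda>t. \<integral>x. exp (t * X x) \<partial>M) has_fps_expansion Abs_fps (\<lambda>k. (\<integral>x. X x ^ k \<partial>M) / fact k)"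
  using exp_moment_sums(1)[OF assms, where 'b = real]
  by (intro has_fps_expansionI_real[of 1]) simp_all

text \<open>
The moment generating function near \<open>0\<close> fixes all moments by uniqueness of power series
coefficients, and for a bounded variable the moments fix the characteristic function on the
whole line.
\<close>

lemma bounded_distribution_eq_if_mgf_eq:
  fixes M N :: "real measure"
  assumes M: "real_distribution M" "AE x in M. \<bar>x\<bar> \<le> C"
    and N: "real_distribution N" "AE x in N. \<bar>x\<bar> \<le> C"
    and "r > 0" and eq: "\<And>t. \<bar>t\<bar> < r \<Longrightarrow> (\<integral>x. exp (t * x) \<partial>M) = (\<integral>x. exp (t * x) \<partial>N)"
  shows "M = N"
proof (rule Levy_uniqueness[OF M(1) N(1)])
  interpret M: real_distribution M by fact
  interpret N: real_distribution N by fact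
  have "(\<lambda>x. x) \<in> borel_measurable M" "(\<lambda>x. x) \<in> borel_measurable N" by auto
  note MM = M.prob_space_axioms this(1) M(2) and NN = N.prob_space_axioms this(2) N(2)
  have "(\<lambda>t. \<integral>x. exp (t * x) \<partial>M) has_fps_expansion Abs_fps (\<lambda>k. (\<integral>x. x ^ k \<partial>N) / fact k)"
    using exp_moment_sums(1)[OF NN, where 'b = real] eq
    by (intro has_fps_expansionI_real[OF \<open>r > 0\<close>]) simp_all
  from has_fps_expansion_unique_real[OF this mgf_has_fps_expansion[OF MM]]
  have moments: "(\<integral>x. x ^ k \<partial>N) = (\<integral>x. x ^ k \<partial>M)" for k
    by (simp add: fps_eq_iff)
  show "char M = char N"
  proof
    fix t
    show "char M t = char N t"
      using sums_unique2[OF exp_moment_sums(1)[OF MM, of "\<i> * of_real t"],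
          of "\<integral>x. exp (\<i> * of_real t * of_real x) \<partial>N"]
        exp_moment_sums(1)[OF NN, of "\<i> * of_real t"]
      by (simp add: char_def moments mult.assoc)
  qed
qed

text \<open>
Weak convergence only controls bounded continuous test functions. The bound on the support is
tested with the distance to \<open>{-C..C}\<close>, cut off at \<open>1\<close>; the exponential is tested after
clamping its argument to \<open>{-C..C}\<close>, which changes nothing on the supports.
\<close>

lemma weak_limit_bounded:
  fixes \<mu> :: "nat \<Rightarrow> real measure"
  assumes \<mu>: "\<And>n. real_distribution (\<mu> n)" "\<And>n. AE x in \<mu> n. \<bar>x\<bar> \<le> C"
    and M: "real_distribution M" and weak: "weak_conv_m \<mu> M"
  shows "AE x in M. \<bar>x\<bar> \<le> C"
    and "(\<lambda>n. \<integral>x. exp (t * x) \<partial>\<mu> n) \<longlonglongrightarrow> (\<integral>x. exp (t * x) \<partial>M)"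
proof -
  interpret M: real_distribution M by fact
  interpret \<mu>: real_distribution "\<mu> n" for n by fact
  have lim: "(\<lambda>n. integral\<^sup>L (\<mu> n) f) \<longlonglongrightarrow> integral\<^sup>L M f"
    if "\<And>x. isCont f x" "\<And>x. norm (f x) \<le> B" for f :: "real \<Rightarrow> real" and B
    using weak_conv_imp_integral_bdd_continuous_conv[OF \<mu>(1) M weak, of f B] that by blast
  define d :: "real \<Rightarrow> real" where "d x = min 1 (max 0 (\<bar>x\<bar> - C))" for x
  have d_cont: "isCont d x" for x unfolding d_def by (intro continuous_intros)
  have d_le: "norm (d x) \<le> 1" for x unfolding d_def by (simp add: abs_le_iff)
  have d[measurable]: "d \<in> borel_measurable borel" unfolding d_def by measurable
  have "integral\<^sup>L (\<mu> n) d = (\<integral>x. 0 \<partial>\<mu> n)" for n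
  proof (rule integral_cong_AE)
    show "AE x in \<mu> n. d x = 0"
      using \<mu>(2)[of n] by eventually_elim (simp add: d_def)
  qed measurable
  then have "(\<lambda>n. 0) \<longlonglongrightarrow> integral\<^sup>L M d"
    using lim[OF d_cont d_le] by simp
  then have "integral\<^sup>L M d = 0" by (simp add: LIMSEQ_const_iff)
  moreover have "integrable M d"
    by (rule M.integrable_const_bound[of _ 1]) (use d_le in auto)
  ultimately have "AE x in M. d x = 0"
    using integral_nonneg_eq_0_iff_AE[of M d] by (simp add: d_def)
  then show bM: "AE x in M. \<bar>x\<bar> \<le> C"
    by eventually_elim (auto simp: d_def min_def max_def split: if_splits)
  define g where "g x = exp (t * max (- C) (min C x))" for x
  have g_cont: "isCont g x" for x unfolding g_def by (intro continuous_intros)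
  have g[measurable]: "g \<in> borel_measurable borel" unfolding g_def by measurable
  have eq: "(\<integral>x. exp (t * x) \<partial>\<nu>) = integral\<^sup>L \<nu> g"
    if "AE x in \<nu>. \<bar>x\<bar> \<le> C" and [measurable_cong]: "sets \<nu> = sets borel" for \<nu>
  proof (rule integral_cong_AE)
    show "AE x in \<nu>. exp (t * x) = g x"
      using that(1)
    proof eventually_elim
      case (elim x)
      then have "max (- C) (min C x) = x" by auto
      then show ?case by (simp add: g_def)
    qed
  qed measurable
  have "norm (g x) \<le> exp (\<bar>t\<bar> * \<bar>C\<bar>)" for x
  proof -
    have "t * max (- C) (min C x) \<le> \<bar>t\<bar> * \<bar>max (- C) (min C x)\<bar>"
      by (metis abs_ge_self abs_mult)
    also have "\<dots> \<le> \<bar>t\<bar> * \<bar>C\<bar>"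
      by (intro mult_left_mono) (auto simp: min_def max_def)
    finally show ?thesis by (simp add: g_def)
  qed
  from lim[OF _ this] show "(\<lambda>n. \<integral>x. exp (t * x) \<partial>\<mu> n) \<longlonglongrightarrow> (\<integral>x. exp (t * x) \<partial>M)"
    using eq[OF bM] eq[OF \<mu>(2)] g_cont by simp
qed

text \<open>
Curtiss' theorem for uniformly bounded variables. A common compact support gives tightness, so
by Helly's selection theorem a subsequence converges. Every subsequential limit is bounded and
has moment generating function \<open>m\<close> near \<open>0\<close>, hence they all coincide and the whole sequence
converges. No candidate for the limit has to be constructed beforehand.
\<close>

lemma bounded_weak_limit_if_mgf_converges:
  fixes \<mu> :: "nat \<Rightarrow> real measure"
  assumes \<mu>: "\<And>n. real_distribution (\<mu> n)" "\<And>n. AE x in \<mu> n. \<bar>x\<bar> \<le> C"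
    and "r > 0" and mgf: "\<And>t. \<bar>t\<bar> < r \<Longrightarrow> (\<lambda>n. \<integral>x. exp (t * x) \<partial>\<mu> n) \<longlonglongrightarrow> m t"
  obtains M where "real_distribution M" "weak_conv_m \<mu> M" "AE x in M. \<bar>x\<bar> \<le> C"
    "\<And>t. \<bar>t\<bar> < r \<Longrightarrow> (\<integral>x. exp (t * x) \<partial>M) = m t"
proof -
  have tight: "tight \<mu>"
    unfolding tight_def
  proof (intro conjI allI impI \<mu>(1))
    fix e :: real assume "e > 0"
    have "measure (\<mu> n) {- \<bar>C\<bar> - 1<..\<bar>C\<bar>} = 1" for n
    proof -
      interpret real_distribution "\<mu> n" by fact
      show ?thesis
        by (subst prob_eq_1) (use \<mu>(2)[of n] in \<open>auto elim!: AE_mp\<close>)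
    qed
    then show "\<exists>a b. a < b \<and> (\<forall>n. measure (\<mu> n) {a<..b} > 1 - e)"
      using \<open>e > 0\<close> by (intro exI[of _ "- \<bar>C\<bar> - 1"] exI[of _ "\<bar>C\<bar>"]) auto
  qed
  have mgf_subseq: "(\<integral>x. exp (t * x) \<partial>\<nu>) = m t"
    if "strict_mono s" "real_distribution \<nu>" "weak_conv_m (\<mu> \<circ> s) \<nu>" "\<bar>t\<bar> < r" for s \<nu> t
  proof (rule LIMSEQ_unique)
    show "(\<lambda>n. \<integral>x. exp (t * x) \<partial>(\<mu> \<circ> s) n) \<longlonglongrightarrow> (\<integral>x. exp (t * x) \<partial>\<nu>)"
      by (rule weak_limit_bounded(2)[of "\<mu> \<circ> s" C, OF _ _ that(2,3)]) (unfold o_apply, (rule \<mu>)+)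
    show "(\<lambda>n. \<integral>x. exp (t * x) \<partial>(\<mu> \<circ> s) n) \<longlonglongrightarrow> m t"
      using LIMSEQ_subseq_LIMSEQ[OF mgf[OF that(4)] that(1)] by (simp add: o_def)
  qed
  obtain s M where s: "strict_mono (s :: nat \<Rightarrow> nat)" and M: "real_distribution M"
      and sM: "weak_conv_m (\<mu> \<circ> s) M"
    using tight_imp_convergent_subsubsequence[OF tight strict_mono_id] by auto
  have bM: "AE x in M. \<bar>x\<bar> \<le> C"
    by (rule weak_limit_bounded(1)[of "\<mu> \<circ> s" C, OF _ _ M sM]) (unfold o_apply, (rule \<mu>)+)
  have weak: "weak_conv_m \<mu> M"
  proof (rule tight_subseq_weak_converge[OF \<mu>(1) M tight])
    fix q \<nu> assume q: "strict_mono (q :: nat \<Rightarrow> nat)" "real_distribution \<nu>" "weak_conv_m (\<mu> \<circ> q) \<nu>"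
    have b\<nu>: "AE x in \<nu>. \<bar>x\<bar> \<le> C"
      by (rule weak_limit_bounded(1)[of "\<mu> \<circ> q" C, OF _ _ q(2,3)]) (unfold o_apply, (rule \<mu>)+)
    have "\<nu> = M"
      using bounded_distribution_eq_if_mgf_eq[OF q(2) b\<nu> M bM \<open>r > 0\<close>] mgf_subseq[OF q] mgf_subseq[OF s M sM]
      by simp
    with q show "weak_conv_m (\<mu> \<circ> q) M" by simp
  qed
  show thesis
    using that[OF M weak bM] mgf_subseq[OF s M sM] by blast
qed

text \<open>
Writing \<open>f\<close> for the moment generating function, \<open>f' = (ln f)' f\<close>. Comparing the coefficients of
order \<open>0\<close> and \<open>1\<close> expresses the first two moments through the first two cumulants.
\<close>

lemma first_two_cumulants:
  fixes X :: "'a \<Rightarrow> real"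
  assumes M: "prob_space M" and X[measurable]: "X \<in> borel_measurable M" and bound: "AE x in M. \<bar>X x\<bar> \<le> C"
    and \<kappa>: "has_cumulants M X \<kappa>"
  shows "\<kappa> 1 = (\<integral>x. X x \<partial>M)" and "\<kappa> 2 = (\<integral>x. (X x - (\<integral>x. X x \<partial>M))\<^sup>2 \<partial>M)"
proof -
  interpret prob_space M by fact
  define f where "f t = (\<integral>x. exp (t * X x) \<partial>M)" for t
  define F where "F = Abs_fps (\<lambda>k. (\<integral>x. X x ^ k \<partial>M) / fact k)"
  define G where "G = Abs_fps (\<lambda>j. \<kappa> j / fact j)"
  have F: "f has_fps_expansion F"
    unfolding f_def F_def by (rule mgf_has_fps_expansion[OF M X bound])
  have G: "(\<lambda>t. ln (f t)) has_fps_expansion G"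
    using \<kappa> by (simp add: has_cumulants_def f_def G_def)
  have pos: "f t > 0" for t
    unfolding f_def
    using exp_moment_sums(2)[OF M X bound, of t] by (intro expectation_greater) auto
  have sums: "(\<lambda>k. (\<integral>x. X x ^ k \<partial>M) / fact k * t ^ k) sums f t" for t
    using exp_moment_sums(1)[OF M X bound, of t] by (simp add: f_def)
  then have "f = (\<lambda>t. \<Sum>k. (\<integral>x. X x ^ k \<partial>M) / fact k * t ^ k)"
    by (auto simp: sums_iff fun_eq_iff)
  moreover have "(\<lambda>t. \<Sum>k. (\<integral>x. X x ^ k \<partial>M) / fact k * t ^ k) field_differentiable at t" for t
    unfolding field_differentiable_def
    by (rule exI, rule termdiffs_strong_converges_everywhere) (use sums in \<open>auto simp: sums_iff\<close>)
  ultimately have df: "f field_differentiable at t" for t by simp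
  have "(\<lambda>t. deriv (\<lambda>t. ln (f t)) t * f t) = deriv f"
  proof
    fix t
    have "(f has_real_derivative deriv f t) (at t)"
      using df[of t] by (simp add: DERIV_deriv_iff_field_differentiable)
    then have "((\<lambda>t. ln (f t)) has_real_derivative deriv f t / f t) (at t)"
      using pos[of t] by (auto intro!: derivative_eq_intros simp: divide_inverse)
    then show "deriv (\<lambda>t. ln (f t)) t * f t = deriv f t"
      using pos[of t] by (simp add: DERIV_imp_deriv)
  qed
  then have "fps_deriv F = fps_deriv G * F"
    using has_fps_expansion_unique_real[OF has_fps_expansion_deriv[OF F]]
      has_fps_expansion_mult[OF has_fps_expansion_deriv[OF G] F] by simp
  then have "fps_nth (fps_deriv F) 0 = fps_nth (fps_deriv G * F) 0"
     "fps_nth (fps_deriv F) 1 = fps_nth (fps_deriv G * F) 1" by simp_all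
  then have 1: "(\<integral>x. X x \<partial>M) = \<kappa> 1" and 2: "(\<integral>x. X x ^ 2 \<partial>M) = \<kappa> 2 + \<kappa> 1 ^ 2"
    by (simp_all add: F_def G_def fps_mult_nth prob_space numeral_2_eq_2)
  show "\<kappa> 1 = (\<integral>x. X x \<partial>M)" using 1 by simp
  show "\<kappa> 2 = (\<integral>x. (X x - (\<integral>x. X x \<partial>M))\<^sup>2 \<partial>M)"
  proof -
    have "integrable M X"
      using bound by (intro integrable_const_bound[of _ C]) auto
    moreover have "integrable M (\<lambda>x. (X x)\<^sup>2)"
    proof (rule integrable_const_bound)
      show "AE x in M. norm ((X x)\<^sup>2) \<le> C\<^sup>2"
        using bound by eventually_elim (simp add: abs_le_square_iff[symmetric])
    qed simp
    ultimately show ?thesis using 1 2 by (subst variance_eq) simp_all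
  qed
qed

section \<open>The logarithm of the hyperbolic sinc function\<close>

text \<open>
The moment generating function of the uniform distribution on \<open>{-1/2..1/2}\<close>.
\<close>

definition sinhc :: "real \<Rightarrow> real" where
  "sinhc x = (if x = 0 then 1 else 2 * sinh (x / 2) / x)"

text \<open>
The Taylor coefficients of \<open>ln \<circ> sinhc\<close> at \<open>0\<close>; see \<open>ln_sinhc_sums\<close>. The Bernoulli formula would
give \<open>-1/2\<close> at \<open>n = 1\<close>, but \<open>sinhc\<close> is the centred version of \<open>(e\<^sup>x - 1) / x\<close>, and centring
removes exactly the linear term.
\<close>

definition log_sinhc_coeff :: "nat \<Rightarrow> real" where
  "log_sinhc_coeff n = (if n < 2 then 0 else bernoulli n / (real n * fact n))"

lemma sinhc_pos: "sinhc x > 0"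
  by (cases "x > 0") (auto simp: sinhc_def divide_neg_neg)

lemma sinhc_minus [simp]: "sinhc (- x) = sinhc x"
  by (simp add: sinhc_def)

lemma isCont_sinhc_0: "isCont sinhc 0"
proof -
  have "((\<lambda>x. 2 * sinh (x / 2)) has_real_derivative 1) (at 0)"
    by (auto intro!: derivative_eq_intros)
  then have "(\<lambda>x. 2 * sinh (x / 2) / x) \<midarrow>0\<rightarrow> (1 :: real)"
    by (simp add: DERIV_def)
  then have "sinhc \<midarrow>0\<rightarrow> 1"
    by (rule Lim_transform_eventually) (simp add: eventually_at_filter sinhc_def)
  then show ?thesis by (simp add: isCont_def sinhc_def)
qed

text \<open>
Coefficients \<open>1\<close>, \<open>2\<close> and \<open>3\<close> of the generating function identity.
\<close>

lemma bernoulli_0_1_2: "bernoulli 0 = 1" "bernoulli (Suc 0) = - 1 / 2" "bernoulli 2 = 1 / 6"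
proof -
  have *: "(\<Sum>i\<le>k. bernoulli i / fact i * fps_nth (fps_exp 1 - 1) (k - i)) = fps_nth fps_X k" for k
    unfolding bernoulli_generating_function[symmetric] by (simp add: fps_mult_nth atLeast0AtMost)
  show 0: "bernoulli 0 = 1" using *[of 1] by simp
  show 1: "bernoulli (Suc 0) = - 1 / 2" using *[of 2] 0 by (simp add: numeral_2_eq_2)
  show "bernoulli 2 = 1 / 6"
    using *[of 3] 0 1 by (simp add: numeral_2_eq_2 numeral_3_eq_3)
qed

lemma bernoulli_sums:
  obtains r where "r > 0"
    "\<And>x. \<bar>x\<bar> < r \<Longrightarrow> (\<lambda>n. bernoulli n / fact n * x ^ n) sums (if x = 0 then 1 else x / (exp x - 1))"
proof -
  have nz: "fps_nth (fps_exp 1 - 1 :: real fps) 1 \<noteq> 0" by simp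
  have sd: "subdegree (fps_exp 1 - 1 :: real fps) = 1"
    by (rule subdegreeI) auto
  have "(\<lambda>x::real. if x = 0 then 1 else x / (exp x - 1)) has_fps_expansion fps_X / (fps_exp 1 - 1)"
    (is "?f has_fps_expansion ?F")
    by (intro has_fps_expansion_divide fps_expansion_intros) (use nz sd in auto)
  then have pos: "fps_conv_radius ?F > 0" and ev: "\<forall>\<^sub>F x in nhds 0. eval_fps ?F x = ?f x"
    by (auto simp: has_fps_expansion_def)
  from pos have "\<forall>\<^sub>F x in nhds 0. x \<in> eball 0 (fps_conv_radius ?F)"
    by (intro eventually_nhds_in_open) (auto simp: zero_ereal_def)
  with ev have "\<forall>\<^sub>F x in nhds 0. (\<lambda>n. fps_nth ?F n * x ^ n) sums ?f x"
    
  proof eventually_elim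
    case (elim x)
    then show ?case using sums_eval_fps[of x ?F] by (auto simp: in_eball_iff)
  qed
  then obtain r where "r > 0" "\<And>x. \<bar>x\<bar> < r \<Longrightarrow> (\<lambda>n. fps_nth ?F n * x ^ n) sums ?f x"
    by (auto simp: eventually_nhds_metric dist_norm)
  with that[of r] show thesis by (simp add: bernoulli_def)
qed

text \<open>
Away from \<open>0\<close> the derivative of \<open>ln (sinhc x)\<close> is \<open>coth (x/2) / 2 - 1 / x\<close>, which equals
\<open>(x / (e\<^sup>x - 1) - 1 + x / 2) / x\<close>: the Bernoulli series without its first two terms, divided by
\<open>x\<close>. Integrating termwise divides the coefficient of \<open>x\<^sup>n\<close> by \<open>n\<close>. The formula for the
derivative is singular at \<open>0\<close>, so the two sides are compared on either side of \<open>0\<close> and joined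
by continuity.
\<close>

lemma ln_sinhc_sums:
  obtains r where "r > 0" "\<And>x. \<bar>x\<bar> < r \<Longrightarrow> (\<lambda>n. log_sinhc_coeff n * x ^ n) sums ln (sinhc x)"
proof -
  let ?c = log_sinhc_coeff
  obtain r where "r > 0" and
    r: "\<And>x. \<bar>x\<bar> < r \<Longrightarrow> (\<lambda>n. bernoulli n / fact n * x ^ n) sums (if x = 0 then 1 else x / (exp x - 1))"
    using bernoulli_sums by blast
  have summ: "summable (\<lambda>n. ?c n * x ^ n)" if "\<bar>x\<bar> < r" for x
  proof (rule summable_comparison_test')
    obtain y where "\<bar>x\<bar> < y" "y < r" using dense[OF \<open>\<bar>x\<bar> < r\<close>] by blast
    then show "summable (\<lambda>n. norm (bernoulli n / fact n * x ^ n))"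
      using r[of y] by (intro powser_insidea[of _ y]) (auto simp: sums_iff)
    show "norm (?c n * x ^ n) \<le> norm (bernoulli n / fact n * x ^ n)" for n
    proof (cases "n < 2")
      case False
      then have "\<bar>bernoulli n\<bar> / (real n * fact n) \<le> \<bar>bernoulli n\<bar> / fact n"
        by (intro divide_left_mono) auto
      then show ?thesis using False
        using mult_right_mono[of _ _ "\<bar>x ^ n\<bar>"] by (fastforce simp: log_sinhc_coeff_def abs_mult)
    qed (simp add: log_sinhc_coeff_def)
  qed
  define f where "f x = (\<Sum>n. ?c n * x ^ n)" for x
  define f' where "f' x = (\<Sum>n. diffs ?c n * x ^ n)" for x
  have f': "(f has_real_derivative f' x) (at x)" if "\<bar>x\<bar> < r" for x
    unfolding f_def f'_def using summ that by (intro termdiffs_strong'[where K = r]) auto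
  have f'_eq: "f' x = 1 / (exp x - 1) + 1 / 2 - 1 / x" if "\<bar>x\<bar> < r" "x \<noteq> 0" for x
  proof -
    have "(\<lambda>n. diffs ?c n * x ^ n) sums f' x"
      unfolding f'_def using termdiff_converges[of x r ?c] summ that by (simp add: summable_sums)
    then have "(\<lambda>n. diffs ?c (Suc n) * x ^ Suc n) sums f' x"
      by (subst sums_Suc_iff) (simp add: diffs_def log_sinhc_coeff_def)
    then have "(\<lambda>n. x * (diffs ?c (Suc n) * x ^ Suc n)) sums (x * f' x)"
      by (rule sums_mult)
    moreover have "x * (diffs ?c (Suc n) * x ^ Suc n) = bernoulli (n + 2) / fact (n + 2) * x ^ (n + 2)" for n
      by (simp add: diffs_def log_sinhc_coeff_def divide_simps)
    moreover have "(\<lambda>n. bernoulli (n + 2) / fact (n + 2) * x ^ (n + 2)) sums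
        (x / (exp x - 1) - (\<Sum>n<2. bernoulli n / fact n * x ^ n))"
      using r[OF that(1)] that(2) by (intro sums_split_initial_segment) simp
    ultimately have "x * f' x = x / (exp x - 1) - (1 - x / 2)"
      by (simp add: sums_unique2 numeral_2_eq_2 bernoulli_0_1_2)
    then show ?thesis using that(2) by (simp add: field_simps)
  qed
  define h where "h = (\<lambda>x. f x - ln (sinhc x))"
  have h': "(h has_real_derivative 0) (at x)" if "\<bar>x\<bar> < r" "x \<noteq> 0" for x
  proof -
    have s: "2 * sinh (x / 2) / x > 0" using sinhc_pos[of x] that by (simp add: sinhc_def)
    have "((\<lambda>x. ln (2 * sinh (x / 2) / x)) has_real_derivative (1 / (exp x - 1) + 1 / 2 - 1 / x)) (at x)"
    proof -
      have "(cosh (x / 2) * x - 2 * sinh (x / 2)) / (x * x) / (2 * sinh (x / 2) / x)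
          = cosh (x / 2) / (2 * sinh (x / 2)) - 1 / x"
        using that(2) s by (auto simp: field_simps)
      also have "cosh (x / 2) / (2 * sinh (x / 2)) = 1 / (exp x - 1) + 1 / 2"
      proof -
        have "exp x = exp (x / 2) * exp (x / 2)" by (simp flip: exp_add)
        moreover have "exp x \<noteq> 1" using that by simp
        ultimately show ?thesis using s
          by (simp add: sinh_field_def cosh_field_def exp_minus field_simps)
      qed
      finally show ?thesis using that(2) s
        by (auto intro!: derivative_eq_intros simp: divide_simps)
    qed
    moreover have "\<forall>\<^sub>F y in nhds x. ln (sinhc y) = ln (2 * sinh (y / 2) / y)"
      using t1_space_nhds[OF that(2)] by eventually_elim (simp add: sinhc_def)
    ultimately have "((\<lambda>x. ln (sinhc x)) has_real_derivative (1 / (exp x - 1) + 1 / 2 - 1 / x)) (at x)"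
      by (subst DERIV_cong_ev[OF refl _ refl])
    from DERIV_diff[OF f'[OF that(1)] this] f'_eq[OF that] show ?thesis
      by (simp add: h_def)
  qed
  have "isCont h 0"
    unfolding h_def using DERIV_isCont[OF f'[of 0]] isCont_sinhc_0 sinhc_pos[of 0] \<open>r > 0\<close>
    by (intro continuous_intros) auto
  then have cont: "isCont h x" if "\<bar>x\<bar> < r" for x
    using h'[OF that] DERIV_isCont by blast
  have "h x = 0" if "\<bar>x\<bar> < r" for x
  proof -
    have "h x = h 0"
    proof (cases x "0 :: real" rule: linorder_cases)
      case less
      have "h 0 = h x"
        by (rule DERIV_isconst_end[OF less]) (use that less cont h' in \<open>auto intro!: continuous_at_imp_continuous_on\<close>)
      then show ?thesis by simp
    next
      case greater
      show ?thesis
        by (rule DERIV_isconst_end[OF greater]) (use that greater cont h' in \<open>auto intro!: continuous_at_imp_continuous_on\<close>)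
    qed simp
    also have "h 0 = 0"
      by (simp add: h_def f_def sinhc_def log_sinhc_coeff_def)
    finally show ?thesis .
  qed
  then have "(\<lambda>n. ?c n * x ^ n) sums ln (sinhc x)" if "\<bar>x\<bar> < r" for x
    using summ[OF that] that by (simp add: sums_iff h_def f_def)
  with \<open>r > 0\<close> that show thesis by blast
qed

text \<open>
A consequence of \<open>sinhc\<close> being even; it contains the vanishing of the Bernoulli numbers of
odd order at least \<open>3\<close>.
\<close>

lemma log_sinhc_coeff_odd: "odd n \<Longrightarrow> log_sinhc_coeff n = 0"
proof -
  assume "odd n"
  obtain r where "r > 0" and r: "\<And>x. \<bar>x\<bar> < r \<Longrightarrow> (\<lambda>n. log_sinhc_coeff n * x ^ n) sums ln (sinhc x)"
    using ln_sinhc_sums by blast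
  have "(\<lambda>n. (- 1) ^ n * log_sinhc_coeff n * x ^ n) sums ln (sinhc x)" if "\<bar>x\<bar> < r" for x
    using r[of "- x"] that by (simp add: power_minus[of x] mult_ac)
  then have "Abs_fps (\<lambda>n. (- 1) ^ n * log_sinhc_coeff n) = Abs_fps log_sinhc_coeff"
    by (rule has_fps_expansion_unique_real[OF has_fps_expansionI_real[OF \<open>r > 0\<close>]
          has_fps_expansionI_real[OF \<open>r > 0\<close> r]])
  then have "(- 1) ^ n * log_sinhc_coeff n = log_sinhc_coeff n"
    by (simp add: fps_eq_iff)
  with \<open>odd n\<close> show ?thesis by simp
qed

section \<open>The moment generating function, mean and variance of the sum\<close>

text \<open>
Multiplied by \<open>2 sinh (t/2)\<close>, the geometric sum telescopes.
\<close>

lemma sum_exp_centred: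
  assumes "n \<ge> 1"
  shows "(\<Sum>k<n. exp (t * (real k - (real n - 1) / 2))) = real n * (sinhc (real n * t) / sinhc t)"
proof (cases "t = 0")
  case False
  define e where "e k = exp (t * (real k - real n / 2))" for k
  have "2 * sinh (t / 2) * exp (t * (real k - (real n - 1) / 2)) = e (Suc k) - e k" for k
  proof -
    have "exp (t / 2) * exp (t * (real k - (real n - 1) / 2)) = e (Suc k)"
      "exp (- (t / 2)) * exp (t * (real k - (real n - 1) / 2)) = e k"
      unfolding e_def exp_add[symmetric] by (rule arg_cong[of _ _ exp]; simp add: field_simps)+
    then show ?thesis by (simp add: sinh_field_def left_diff_distrib)
  qed
  then have "2 * sinh (t / 2) * (\<Sum>k<n. exp (t * (real k - (real n - 1) / 2))) = (\<Sum>k<n. e (Suc k) - e k)"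
    by (simp add: sum_distrib_left)
  also have "\<dots> = e n - e 0" by (rule sum_lessThan_telescope)
  also have "\<dots> = 2 * sinh (real n * t / 2)"
    by (simp add: e_def sinh_field_def) (simp add: algebra_simps)
  finally have "(\<Sum>k<n. exp (t * (real k - (real n - 1) / 2))) = sinh (real n * t / 2) / sinh (t / 2)"
    using False by (simp add: field_simps)
  then show ?thesis using False assms by (simp add: sinhc_def)
qed (use assms in \<open>simp add: sinhc_def\<close>)

text \<open>
The sum of the midpoints of \<open>{0..2 ^ j - 1}\<close>. It equals \<open>mu\<close>, but this is only derived in
\<open>mu_sigma\<close>, from the cumulants of \<open>Z N - centre N\<close>.
\<close>

definition centre :: "nat \<Rightarrow> real" where
  "centre N = (\<Sum>j = 1..N. (2 ^ j - 1) / 2)"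

text \<open>
The coordinates of a uniformly chosen tuple are independent: the sum over the product set
factors into one geometric sum for each coordinate.
\<close>

lemma mgf_Z_centred:
  "measure_pmf.expectation (P N) (\<lambda>\<omega>. exp (t * (Z N \<omega> - centre N)))
     = (\<Prod>j = 1..N. sinhc (2 ^ j * t) / sinhc t)"
proof -
  define g where "g j k = exp (t * (of_int k - (2 ^ j - 1) / 2))" for j :: nat and k :: int
  have factor: "(\<Sum>k \<in> {0..2 ^ j - 1}. g j k) = 2 ^ j * (sinhc (2 ^ j * t) / sinhc t)" for j
  proof -
    have "{0..2 ^ j - 1} = int ` {..<2 ^ j}"
      by (auto simp: image_iff intro!: bexI[of _ "nat _"]) 
    then have "(\<Sum>k \<in> {0..2 ^ j - 1}. g j k) = (\<Sum>k<2 ^ j. g j (int k))"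
      by (simp add: sum.reindex)
    then show ?thesis
      using sum_exp_centred[of "2 ^ j" t] by (simp add: g_def)
  qed
  have "exp (t * (Z N \<omega> - centre N)) = (\<Prod>j = 1..N. g j (\<omega> j))" for \<omega>
  proof -
    have "t * (Z N \<omega> - centre N) = (\<Sum>j = 1..N. t * (real_of_int (\<omega> j) - (2 ^ j - 1) / 2))"
      unfolding Z_def centre_def of_int_sum sum_subtractf[symmetric] by (rule sum_distrib_left)
    then show ?thesis by (simp add: g_def exp_sum)
  qed
  then have "measure_pmf.expectation (P N) (\<lambda>\<omega>. exp (t * (Z N \<omega> - centre N)))
      = (\<Sum>\<omega>\<in>Omega N. \<Prod>j = 1..N. g j (\<omega> j)) / real (card (Omega N))"
    unfolding P_def by (simp add: integral_pmf_of_set finite_Omega Omega_nonempty)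
  also have "(\<Sum>\<omega>\<in>Omega N. \<Prod>j = 1..N. g j (\<omega> j)) = (\<Prod>j = 1..N. \<Sum>k \<in> {0..2 ^ j - 1}. g j k)"
    unfolding Omega_def by (rule prod_sum_PiE[symmetric]) auto
  also have "\<dots> = (\<Prod>j = 1..N. 2 ^ j) * (\<Prod>j = 1..N. sinhc (2 ^ j * t) / sinhc t)"
    unfolding factor by (rule prod.distrib)
  also have "(\<Prod>j = 1..N. 2 ^ j :: real) = real (card (Omega N))"
    unfolding Omega_def by (simp add: card_PiE nat_power_eq)
  finally show ?thesis using finite_Omega Omega_nonempty by simp
qed

text \<open>
Coordinate \<open>j\<close> contributes \<open>ln (sinhc (2 ^ j * t)) - ln (sinhc t)\<close> to the logarithm of the moment
generating function, hence the factor \<open>(2 ^ j) ^ n - 1\<close> to its coefficient of order \<open>n\<close>.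
\<close>

definition scale_sum :: "nat \<Rightarrow> nat \<Rightarrow> real" where
  "scale_sum N n = (\<Sum>j = 1..N. (2 ^ j) ^ n - 1)"

lemma ln_mgf_Z_centred_sums:
  assumes r: "\<And>x. \<bar>x\<bar> < r \<Longrightarrow> (\<lambda>n. log_sinhc_coeff n * x ^ n) sums ln (sinhc x)"
    and t: "2 ^ N * \<bar>t\<bar> < r"
  shows "(\<lambda>n. log_sinhc_coeff n * scale_sum N n * t ^ n) sums
    ln (measure_pmf.expectation (P N) (\<lambda>\<omega>. exp (t * (Z N \<omega> - centre N))))"
proof -
  have le: "2 ^ j * \<bar>t\<bar> < r" if "j \<le> N" for j
  proof -
    have "2 ^ j * \<bar>t\<bar> \<le> 2 ^ N * \<bar>t\<bar>"
      using that by (intro mult_right_mono power_increasing) auto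
    with t show ?thesis by simp
  qed
  have "(\<lambda>n. \<Sum>j = 1..N. log_sinhc_coeff n * (2 ^ j * t) ^ n - log_sinhc_coeff n * t ^ n) sums
      (\<Sum>j = 1..N. ln (sinhc (2 ^ j * t)) - ln (sinhc t))"
    by (intro sums_sum sums_diff r) (use le le[of 0] in \<open>auto simp: abs_mult\<close>)
  also have "(\<lambda>n. \<Sum>j = 1..N. log_sinhc_coeff n * (2 ^ j * t) ^ n - log_sinhc_coeff n * t ^ n)
      = (\<lambda>n. log_sinhc_coeff n * scale_sum N n * t ^ n)"
    unfolding scale_sum_def sum_distrib_left sum_distrib_right
    by (intro ext sum.cong) (auto simp: power_mult_distrib algebra_simps)
  also have "(\<Sum>j = 1..N. ln (sinhc (2 ^ j * t)) - ln (sinhc t)) = ln (\<Prod>j = 1..N. sinhc (2 ^ j * t) / sinhc t)"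
    by (subst ln_prod) (auto simp: ln_div sinhc_pos less_imp_neq[OF sinhc_pos, symmetric])
  finally show ?thesis unfolding mgf_Z_centred .
qed

lemma Z_centred_bound: "\<omega> \<in> Omega N \<Longrightarrow> \<bar>Z N \<omega> - centre N\<bar> \<le> 2 ^ N"
proof -
  assume \<omega>: "\<omega> \<in> Omega N"
  have "\<bar>Z N \<omega> - centre N\<bar> = \<bar>\<Sum>j = 1..N. real_of_int (\<omega> j) - (2 ^ j - 1) / 2\<bar>"
    by (simp add: Z_def centre_def sum_subtractf)
  also have "\<dots> \<le> (\<Sum>j = 1..N. 2 ^ j / 2)"
  proof (intro order.trans[OF sum_abs] sum_mono)
    fix j assume "j \<in> {1..N}"
    with \<omega> have "0 \<le> \<omega> j" "\<omega> j \<le> 2 ^ j - 1" by (auto simp: Omega_def PiE_iff)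
    then have "0 \<le> real_of_int (\<omega> j)" "real_of_int (\<omega> j) \<le> real_of_int (2 ^ j - 1)"
      by (simp_all only: of_int_0_le_iff of_int_le_iff)
    then show "\<bar>real_of_int (\<omega> j) - (2 ^ j - 1) / 2\<bar> \<le> 2 ^ j / 2"
      by (simp add: abs_le_iff field_simps)
  qed
  also have "\<dots> \<le> 2 ^ N"
    by (induction N) auto
  finally show ?thesis .
qed

lemma AE_P_iff: "(AE \<omega> in P N. Q \<omega>) \<longleftrightarrow> (\<forall>\<omega>\<in>Omega N. Q \<omega>)"
  by (simp add: AE_measure_pmf_iff P_def finite_Omega Omega_nonempty)

lemma integrable_P: "integrable (P N) (f :: _ \<Rightarrow> real)"
  by (rule integrable_measure_pmf_finite) (simp add: P_def finite_Omega Omega_nonempty)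

text \<open>
Mean and variance of \<open>Z N - centre N\<close> are its first two cumulants, and these are known from the
expansion of the moment generating function; the variance involves \<open>log_sinhc_coeff 2 = 1 / 24\<close>.
\<close>

lemma mu_sigma:
  "mu N = centre N" "sigma N = sqrt (scale_sum N 2 / 12)"
proof -
  obtain r where "r > 0" and r: "\<And>x. \<bar>x\<bar> < r \<Longrightarrow> (\<lambda>n. log_sinhc_coeff n * x ^ n) sums ln (sinhc x)"
    using ln_sinhc_sums by blast
  define X where "X \<omega> = Z N \<omega> - centre N" for \<omega>
  define \<kappa> where "\<kappa> n = fact n * (log_sinhc_coeff n * scale_sum N n)" for n
  have \<kappa>: "has_cumulants (P N) X \<kappa>"
    unfolding has_cumulants_def mgf_finite_near_0_def
  proof (intro conjI has_fps_expansionI_real[of "r / 2 ^ N"])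
    fix t :: real assume "\<bar>t\<bar> < r / 2 ^ N"
    then show "(\<lambda>n. \<kappa> n / fact n * t ^ n) sums ln (\<integral>x. exp (t * X x) \<partial>P N)"
      using ln_mgf_Z_centred_sums[of r N t, OF r] by (simp add: \<kappa>_def X_def field_simps)
  qed (use \<open>r > 0\<close> in \<open>auto simp: integrable_P\<close>)
  note * = first_two_cumulants[OF measure_pmf.prob_space_axioms _ _ \<kappa>, of "2 ^ N"]
  have "\<kappa> 1 = (\<integral>x. X x \<partial>P N)" "\<kappa> 2 = (\<integral>x. (X x - (\<integral>x. X x \<partial>P N))\<^sup>2 \<partial>P N)"
    by (rule *; use Z_centred_bound in \<open>simp add: AE_P_iff X_def\<close>)+
  moreover have "\<kappa> 1 = 0" "\<kappa> 2 = scale_sum N 2 / 12"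
    by (simp_all add: \<kappa>_def log_sinhc_coeff_def bernoulli_0_1_2 fact_numeral)
  ultimately have mean: "(\<integral>x. X x \<partial>P N) = 0" and var: "(\<integral>x. (X x)\<^sup>2 \<partial>P N) = scale_sum N 2 / 12"
    by simp_all
  from mean show "mu N = centre N"
    by (simp add: X_def mu_def integrable_P)
  with var show "sigma N = sqrt (scale_sum N 2 / 12)"
    unfolding sigma_def mu_def[symmetric] by (simp add: X_def)
qed

text \<open>
The last coordinate alone already has variance \<open>(4 ^ N - 1) / 12 \<ge> 4 ^ N / 16\<close>. Hence the
normalisation is of the same order as the largest coordinate, which is why \<open>Zhat N\<close> stays
bounded and the limit is not Gaussian.
\<close>

lemma sigma_ge: "N \<ge> 1 \<Longrightarrow> sigma N \<ge> 2 ^ N / 4"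
proof -
  assume "N \<ge> 1"
  have "3 / 4 * (2 ^ N)\<^sup>2 \<le> (2 ^ N)\<^sup>2 - (1 :: real)"
  proof -
    have "(2 :: real) ^ 1 \<le> 2 ^ N" using \<open>N \<ge> 1\<close> by (intro power_increasing) auto
    then have "(2 :: real)\<^sup>2 \<le> (2 ^ N)\<^sup>2" by (intro power_mono) auto
    then show ?thesis by simp
  qed
  also have "\<dots> \<le> scale_sum N 2"
    unfolding scale_sum_def using \<open>N \<ge> 1\<close>
    by (intro member_le_sum) (auto simp: one_le_power)
  finally have "(2 ^ N / 4)\<^sup>2 \<le> scale_sum N 2 / 12"
    by (simp add: power_divide)
  then show ?thesis unfolding mu_sigma by (rule real_le_rsqrt)
qed

lemma scale_sum_closed:
  assumes "n \<ge> 1"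
  shows "scale_sum N n = 2 ^ n / (2 ^ n - 1) * ((2 ^ N) ^ n - 1) - real N"
proof -
  have "(2 :: real) ^ n > 1" using assms by simp
  then show ?thesis
    by (induction N) (simp_all add: scale_sum_def field_simps power_mult_distrib)
qed

lemma scale_sum_bounds:
  shows "0 \<le> scale_sum N n" "scale_sum N n \<le> 2 * (2 ^ N) ^ n"
proof -
  show "0 \<le> scale_sum N n"
    unfolding scale_sum_def by (intro sum_nonneg) (simp add: one_le_power)
  show "scale_sum N n \<le> 2 * (2 ^ N) ^ n"
  proof (cases "n = 0")
    case False
    have "(2 :: real) ^ 1 \<le> 2 ^ n" using False by (intro power_increasing) auto
    then have "2 ^ n / (2 ^ n - 1) \<le> (2 :: real)" by (simp add: field_simps)
    then have "2 ^ n / (2 ^ n - 1) * ((2 ^ N) ^ n - 1) \<le> 2 * ((2 ^ N) ^ n - 1 :: real)"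
      by (intro mult_right_mono) (auto simp: one_le_power)
    then show ?thesis using False by (simp add: scale_sum_closed)
  qed (simp add: scale_sum_def)
qed

lemma scale_sum_ratio_tendsto:
  assumes "n \<ge> 1"
  shows "(\<lambda>N. scale_sum N n / (2 ^ N) ^ n) \<longlonglongrightarrow> 2 ^ n / (2 ^ n - 1)"
proof -
  define q :: real where "q = 2 ^ n"
  have q: "q > 1" using assms by (simp add: q_def)
  have qN: "(2 ^ N) ^ n = q ^ N" for N by (simp add: q_def power_mult[symmetric] mult.commute)
  have "(\<lambda>N. q / (q - 1) * (1 - (1 / q) ^ N) - real N * (1 / q) ^ N) \<longlonglongrightarrow> q / (q - 1) * (1 - 0) - 0"
    using q by (intro tendsto_intros LIMSEQ_power_zero powser_times_n_limit_0) auto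
  moreover have "q / (q - 1) * (1 - (1 / q) ^ N) - real N * (1 / q) ^ N = scale_sum N n / (2 ^ N) ^ n" for N
    unfolding scale_sum_closed[OF assms] qN q_def[symmetric] using q
    by (simp add: field_simps)
  ultimately show ?thesis by (simp add: q_def)
qed

lemma sigma_ratio_tendsto: "(\<lambda>N. sigma N / 2 ^ N) \<longlonglongrightarrow> 1 / 3"
proof -
  have "(\<lambda>N. sqrt (scale_sum N 2 / (2 ^ N)\<^sup>2 / 12)) \<longlonglongrightarrow> sqrt (2\<^sup>2 / (2\<^sup>2 - 1) / 12)"
    by (intro tendsto_intros scale_sum_ratio_tendsto) auto
  moreover have "sqrt (scale_sum N 2 / (2 ^ N)\<^sup>2 / 12) = sigma N / 2 ^ N" for N
    by (simp add: mu_sigma real_sqrt_divide real_sqrt_mult)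
  moreover have "sqrt (2\<^sup>2 / (2\<^sup>2 - 1) / 12) = (1 / 3 :: real)"
    by (rule real_sqrt_unique) (auto simp: power2_eq_square)
  ultimately show ?thesis by (simp only:)
qed

lemma normalised_scale_sum_tendsto:
  assumes "n \<ge> 1"
  shows "(\<lambda>N. scale_sum N n / sigma N ^ n) \<longlonglongrightarrow> 6 ^ n / (2 ^ n - 1)"
proof -
  have "(\<lambda>N. scale_sum N n / (2 ^ N) ^ n / (sigma N / 2 ^ N) ^ n) \<longlonglongrightarrow> 2 ^ n / (2 ^ n - 1) / (1 / 3) ^ n"
    by (intro tendsto_intros scale_sum_ratio_tendsto sigma_ratio_tendsto assms) auto
  moreover have "2 ^ n / (2 ^ n - 1) / (1 / 3) ^ n = (6 ^ n / (2 ^ n - 1) :: real)"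
    using power_mult_distrib[of 2 "3 :: real" n] by (simp add: power_divide)
  moreover have "scale_sum N n / (2 ^ N) ^ n / (sigma N / 2 ^ N) ^ n = scale_sum N n / sigma N ^ n" for N
    by (simp add: power_divide)
  ultimately show ?thesis by (simp only:)
qed

section \<open>The limit distribution\<close>

text \<open>
The coefficients of the logarithm of the moment generating function of the limit. At \<open>n = 0\<close> both
the first factor and, through division by zero, the second factor are \<open>0\<close>.
\<close>

definition limit_log_mgf_coeff :: "nat \<Rightarrow> real" where
  "limit_log_mgf_coeff n = log_sinhc_coeff n * (6 ^ n / (2 ^ n - 1))"

lemma Zhat_eq: "Zhat N \<omega> = (Z N \<omega> - centre N) / sigma N"
  by (simp add: Zhat_def mu_sigma)

lemma Zhat_bound: "\<omega> \<in> Omega N \<Longrightarrow> \<bar>Zhat N \<omega>\<bar> \<le> 4"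
proof (cases "N = 0")
  case True
  then show ?thesis by (simp add: Zhat_eq mu_sigma scale_sum_def)
next
  case False
  assume "\<omega> \<in> Omega N"
  then have "\<bar>Z N \<omega> - centre N\<bar> \<le> 2 ^ N" by (rule Z_centred_bound)
  also have "\<dots> \<le> 4 * sigma N" using sigma_ge[of N] False by simp
  finally have "\<bar>Z N \<omega> - centre N\<bar> \<le> 4 * sigma N" .
  moreover have "0 < (2 :: real) ^ N / 4" by simp
  then have "sigma N > 0" using sigma_ge[of N] False by linarith
  ultimately show ?thesis by (simp add: Zhat_eq divide_le_eq)
qed

text \<open>
The constant \<open>4\<close> comes from \<open>sigma_ge\<close>: the largest argument of \<open>sinhc\<close> that occurs is
\<open>2 ^ N * t / sigma N\<close>. The radius of convergence is therefore uniform in \<open>N\<close>.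
\<close>

lemma ln_mgf_Zhat_sums:
  assumes r: "\<And>x. \<bar>x\<bar> < r \<Longrightarrow> (\<lambda>n. log_sinhc_coeff n * x ^ n) sums ln (sinhc x)"
    and "N \<ge> 1" and t: "4 * \<bar>t\<bar> < r"
  shows "(\<lambda>n. log_sinhc_coeff n * (scale_sum N n / sigma N ^ n) * t ^ n) sums
    ln (measure_pmf.expectation (P N) (\<lambda>\<omega>. exp (t * Zhat N \<omega>)))"
proof -
  have s: "2 ^ N / 4 \<le> sigma N" using \<open>N \<ge> 1\<close> by (rule sigma_ge)
  moreover have "0 < (2 :: real) ^ N / 4" by simp
  ultimately have "sigma N > 0" by linarith
  have "2 ^ N * \<bar>t\<bar> \<le> 4 * sigma N * \<bar>t\<bar>"
    using s by (intro mult_right_mono) auto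
  with \<open>sigma N > 0\<close> have "2 ^ N * \<bar>t / sigma N\<bar> \<le> 4 * \<bar>t\<bar>"
    by (simp add: field_simps)
  with t have "2 ^ N * \<bar>t / sigma N\<bar> < r" by simp
  from ln_mgf_Z_centred_sums[OF r this] show ?thesis
    by (simp add: Zhat_eq power_divide)
qed

lemma has_cumulants_Zhat:
  assumes "N \<ge> 1"
  shows "has_cumulants (P N) (Zhat N) (\<lambda>n. fact n * (log_sinhc_coeff n * (scale_sum N n / sigma N ^ n)))"
proof -
  obtain r where "r > 0" and r: "\<And>x. \<bar>x\<bar> < r \<Longrightarrow> (\<lambda>n. log_sinhc_coeff n * x ^ n) sums ln (sinhc x)"
    using ln_sinhc_sums by blast
  show ?thesis
    unfolding has_cumulants_def mgf_finite_near_0_def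
  proof (intro conjI has_fps_expansionI_real[of "r / 4"])
    fix t :: real assume "\<bar>t\<bar> < r / 4"
    then show "(\<lambda>n. fact n * (log_sinhc_coeff n * (scale_sum N n / sigma N ^ n)) / fact n * t ^ n) sums
        ln (\<integral>x. exp (t * Zhat N x) \<partial>P N)"
      using ln_mgf_Zhat_sums[of r N t, OF r assms] by simp
  qed (use \<open>r > 0\<close> in \<open>auto simp: integrable_P\<close>)
qed

lemma cumulant_Zhat_tendsto:
  "(\<lambda>N. cumulant (P N) (Zhat N) n) \<longlonglongrightarrow> fact n * limit_log_mgf_coeff n"
proof -
  have "(\<lambda>N. fact n * (log_sinhc_coeff n * (scale_sum N n / sigma N ^ n))) \<longlonglongrightarrow> fact n * limit_log_mgf_coeff n"
  proof (cases "n = 0")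
    case False
    then show ?thesis unfolding limit_log_mgf_coeff_def
      by (intro tendsto_intros normalised_scale_sum_tendsto) auto
  qed (simp add: limit_log_mgf_coeff_def log_sinhc_coeff_def)
  moreover have "\<forall>\<^sub>F N in sequentially. fact n * (log_sinhc_coeff n * (scale_sum N n / sigma N ^ n))
      = cumulant (P N) (Zhat N) n"
    using eventually_ge_at_top[of 1]
    by eventually_elim (simp add: cumulant_eq[OF has_cumulants_Zhat])
  ultimately show ?thesis by (rule Lim_transform_eventually)
qed

text \<open>
Each coefficient converges, and the coefficient of order \<open>n\<close> is at most \<open>2 * 4 ^ n\<close> times that
of \<open>ln \<circ> sinhc\<close>; Tannery's theorem exchanges limit and sum.
\<close>

lemma mgf_Zhat_tendsto:
  assumes r: "\<And>x. \<bar>x\<bar> < r \<Longrightarrow> (\<lambda>n. log_sinhc_coeff n * x ^ n) sums ln (sinhc x)"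
    and t: "4 * \<bar>t\<bar> < r"
  shows "summable (\<lambda>n. limit_log_mgf_coeff n * t ^ n)"
    and "(\<lambda>N. \<integral>x. exp (t * Zhat N x) \<partial>P N) \<longlonglongrightarrow> exp (\<Sum>n. limit_log_mgf_coeff n * t ^ n)"
proof -
  define a where "a n N = log_sinhc_coeff n * (scale_sum N n / sigma N ^ n) * t ^ n" for n N
  define b where "b n = 2 * \<bar>log_sinhc_coeff n * (4 * t) ^ n\<bar>" for n
  have lim: "(\<lambda>N. a n N) \<longlonglongrightarrow> limit_log_mgf_coeff n * t ^ n" for n
  proof (cases "n = 0")
    case False
    then show ?thesis unfolding a_def limit_log_mgf_coeff_def
      by (intro tendsto_intros normalised_scale_sum_tendsto) auto
  qed (simp add: a_def limit_log_mgf_coeff_def log_sinhc_coeff_def)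
  have bound: "norm (a n N) \<le> b n" if "N \<ge> 1" for n N
  proof -
    have "0 < (2 ^ N / 4 :: real) ^ n" by simp
    moreover have "(2 ^ N / 4) ^ n \<le> sigma N ^ n"
      using sigma_ge[OF that] by (intro power_mono) auto
    ultimately have pos: "0 < sigma N ^ n" by linarith
    have "scale_sum N n / sigma N ^ n \<le> 2 * (2 ^ N) ^ n / (2 ^ N / 4) ^ n"
      using \<open>(2 ^ N / 4) ^ n \<le> sigma N ^ n\<close> by (intro frac_le scale_sum_bounds) auto
    also have "\<dots> = 2 * 4 ^ n" by (simp add: power_divide)
    finally have "\<bar>scale_sum N n / sigma N ^ n\<bar> \<le> 2 * 4 ^ n"
      using scale_sum_bounds(1)[of N n] pos by simp
    then have "\<bar>log_sinhc_coeff n * t ^ n\<bar> * \<bar>scale_sum N n / sigma N ^ n\<bar> \<le> \<bar>log_sinhc_coeff n * t ^ n\<bar> * (2 * 4 ^ n)"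
      by (rule mult_left_mono) simp
    then show ?thesis by (simp add: a_def b_def abs_mult power_mult_distrib mult_ac)
  qed
  have "summable b"
  proof -
    obtain y where "\<bar>4 * t\<bar> < y" "y < r" using dense[of "\<bar>4 * t\<bar>" r] t by (auto simp: abs_mult)
    then show ?thesis unfolding b_def
      using r[of y] powser_insidea[of log_sinhc_coeff y "4 * t"]
      by (intro summable_mult) (auto simp: sums_iff)
  qed
  moreover have "\<forall>\<^sub>F (n, N) in sequentially \<times>\<^sub>F sequentially. norm (a n N) \<le> b n"
    using eventually_prodI[OF always_eventually[of "\<lambda>_. True"] eventually_ge_at_top[of 1]] 
    by (rule eventually_mono) (use bound in auto)
  ultimately have tan: "summable (\<lambda>n. norm (limit_log_mgf_coeff n * t ^ n)) \<and>
      (\<lambda>N. \<Sum>n. a n N) \<longlonglongrightarrow> (\<Sum>n. limit_log_mgf_coeff n * t ^ n)"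
    using tannerys_theorem[of a "\<lambda>n. limit_log_mgf_coeff n * t ^ n" sequentially b] lim by simp
  then show "summable (\<lambda>n. limit_log_mgf_coeff n * t ^ n)"
    by (intro summable_norm_cancel[OF conjunct1])
  have "(\<lambda>N. exp (\<Sum>n. a n N)) \<longlonglongrightarrow> exp (\<Sum>n. limit_log_mgf_coeff n * t ^ n)"
    by (rule tendsto_exp[OF conjunct2[OF tan]])
  moreover have "\<forall>\<^sub>F N in sequentially. exp (\<Sum>n. a n N) = (\<integral>x. exp (t * Zhat N x) \<partial>P N)"
    using eventually_ge_at_top[of 1]
  proof eventually_elim
    case (elim N)
    have "(\<integral>x. exp (t * Zhat N x) \<partial>P N) > 0"
      by (intro measure_pmf.expectation_greater) (auto simp: integrable_P)
    then show ?case
      using ln_mgf_Zhat_sums[of r N t, OF r elim t] by (simp add: a_def sums_iff)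
  qed
  ultimately show "(\<lambda>N. \<integral>x. exp (t * Zhat N x) \<partial>P N) \<longlonglongrightarrow> exp (\<Sum>n. limit_log_mgf_coeff n * t ^ n)"
    by (rule Lim_transform_eventually)
qed

text \<open>
A normal distribution charges the interval \<open>{\<bar>C\<bar> + 1..\<bar>C\<bar> + 2}\<close>.
\<close>

lemma cdf_bounded_neq_normal:
  assumes M: "real_distribution M" and bound: "AE x in M. \<bar>x\<bar> \<le> C" and "s > 0"
  shows "cdf M \<noteq> cdf (density lborel (normal_density m s))"
proof
  assume eq: "cdf M = cdf (density lborel (normal_density m s))"
  have "real_distribution (density lborel (normal_density m s))"
    using prob_space_normal_density[OF \<open>s > 0\<close>]
    by (simp add: real_distribution_def real_distribution_axioms_def)
  with M eq have M_eq: "M = density lborel (normal_density m s)"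
    by (intro cdf_unique) auto
  have "AE x in density lborel (normal_density m s). \<bar>x\<bar> \<le> C"
    using bound unfolding M_eq .
  then have "AE x in lborel. 0 < ennreal (normal_density m s x) \<longrightarrow> \<bar>x\<bar> \<le> C"
    by (subst (asm) AE_density) auto
  then have "AE x in lborel. x \<notin> {\<bar>C\<bar> + 1..\<bar>C\<bar> + 2}"
    by eventually_elim (use normal_density_pos[OF \<open>s > 0\<close>] in auto)
  then have "{\<bar>C\<bar> + 1..\<bar>C\<bar> + 2} \<in> null_sets lborel"
    by (subst AE_iff_null_sets) auto
  then show False by (simp add: null_sets_def)
qed

theorem corollary4p1:
  shows "\<exists>(M :: real measure) (Zstar :: real \<Rightarrow> real) (\<Lambda> :: real \<Rightarrow> real).
    prob_space M \<and> Zstar \<in> borel_measurable M \<and>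
    weak_conv_m (\<lambda>N. distr (P N) borel (Zhat N)) (distr M borel Zstar) \<and>
    \<Lambda> = cdf (distr M borel Zstar) \<and>
    mgf_finite_near_0 M Zstar \<and>
    (\<forall>n\<ge>1.
       cumulant M Zstar (2 * n - 1) = 0 \<and>
       (\<lambda>N. cumulant (P N) (Zhat N) (2 * n - 1)) \<longlonglongrightarrow> 0 \<and>
       cumulant M Zstar (2 * n) = bernoulli (2 * n) / real (2 * n) * (6 ^ (2 * n) / (2 ^ (2 * n) - 1)) \<and>
       (\<lambda>N. cumulant (P N) (Zhat N) (2 * n)) \<longlonglongrightarrow>
         bernoulli (2 * n) / real (2 * n) * (6 ^ (2 * n) / (2 ^ (2 * n) - 1))) \<and>
    (\<forall>m s. s > 0 \<longrightarrow> \<Lambda> \<noteq> cdf (density lborel (normal_density m s)))"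
proof -
  obtain r where "r > 0" and r: "\<And>x. \<bar>x\<bar> < r \<Longrightarrow> (\<lambda>n. log_sinhc_coeff n * x ^ n) sums ln (sinhc x)"
    using ln_sinhc_sums by blast
  define \<mu> where "\<mu> N = distr (P N) borel (Zhat N)" for N
  have \<mu>: "real_distribution (\<mu> N)" for N
    unfolding \<mu>_def by (rule prob_space.real_distribution_distr[OF measure_pmf.prob_space_axioms]) simp
  have \<mu>_bound: "AE x in \<mu> N. \<bar>x\<bar> \<le> 4" for N
    unfolding \<mu>_def by (subst AE_distr_iff) (auto simp: AE_P_iff Zhat_bound)
  have \<mu>_mgf: "(\<integral>x. exp (t * x) \<partial>\<mu> N) = (\<integral>\<omega>. exp (t * Zhat N \<omega>) \<partial>P N)" for N t
    unfolding \<mu>_def by (rule integral_distr) simp_all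
  obtain M where M: "real_distribution M" and weak: "weak_conv_m \<mu> M" and bound: "AE x in M. \<bar>x\<bar> \<le> 4"
    and mgf: "\<And>t. \<bar>t\<bar> < r / 4 \<Longrightarrow> (\<integral>x. exp (t * x) \<partial>M) = exp (\<Sum>n. limit_log_mgf_coeff n * t ^ n)"
  proof (rule bounded_weak_limit_if_mgf_converges[OF \<mu> \<mu>_bound])
    show "r / 4 > 0" using \<open>r > 0\<close> by simp
    show "(\<lambda>N. \<integral>x. exp (t * x) \<partial>\<mu> N) \<longlonglongrightarrow> exp (\<Sum>n. limit_log_mgf_coeff n * t ^ n)" if "\<bar>t\<bar> < r / 4" for t
      unfolding \<mu>_mgf using mgf_Zhat_tendsto(2)[of r t, OF r] that by simp
  qed blast
  interpret M: real_distribution M by fact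
  have cum: "has_cumulants M (\<lambda>x. x) (\<lambda>n. fact n * limit_log_mgf_coeff n)"
    unfolding has_cumulants_def mgf_finite_near_0_def
  proof (intro conjI has_fps_expansionI_real[of "r / 4"] always_eventually allI)
    fix t :: real
    show "integrable M (\<lambda>x. exp (t * x))"
      using exp_moment_sums(2)[OF M.prob_space_axioms _ bound, of t] by simp
    assume "\<bar>t\<bar> < r / 4"
    then show "(\<lambda>n. fact n * limit_log_mgf_coeff n / fact n * t ^ n) sums ln (\<integral>x. exp (t * x) \<partial>M)"
      using mgf_Zhat_tendsto(1)[of r t, OF r] mgf[of t] by (simp add: summable_sums)
  qed (use \<open>r > 0\<close> in simp)
  have odd: "fact (2 * n - 1) * limit_log_mgf_coeff (2 * n - 1) = 0" if "n \<ge> 1" for n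
    using that by (simp add: limit_log_mgf_coeff_def log_sinhc_coeff_odd)
  have even: "fact (2 * n) * limit_log_mgf_coeff (2 * n)
      = bernoulli (2 * n) / real (2 * n) * (6 ^ (2 * n) / (2 ^ (2 * n) - 1))" if "n \<ge> 1" for n
    using that by (simp add: limit_log_mgf_coeff_def log_sinhc_coeff_def)
  have distr: "distr M borel (\<lambda>x. x) = M"
    by (rule distr_id2) simp
  show ?thesis
  proof (rule exI[of _ M], rule exI[of _ "\<lambda>x. x"], rule exI[of _ "cdf M"], intro conjI allI impI)
    show "weak_conv_m (\<lambda>N. distr (P N) borel (Zhat N)) (distr M borel (\<lambda>x. x))"
      unfolding distr using weak by (simp add: \<mu>_def[abs_def])
    show "mgf_finite_near_0 M (\<lambda>x. x)" using cum by (simp add: has_cumulants_def)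
    show "cdf M \<noteq> cdf (density lborel (normal_density m s))" if "s > 0" for m s
      using cdf_bounded_neq_normal[OF M bound that] .
    fix n :: nat assume n: "n \<ge> 1"
    show "cumulant M (\<lambda>x. x) (2 * n - 1) = 0"
      "cumulant M (\<lambda>x. x) (2 * n) = bernoulli (2 * n) / real (2 * n) * (6 ^ (2 * n) / (2 ^ (2 * n) - 1))"
      unfolding cumulant_eq[OF cum] using odd even n by blast+
    show "(\<lambda>N. cumulant (P N) (Zhat N) (2 * n - 1)) \<longlonglongrightarrow> 0"
      using cumulant_Zhat_tendsto[of "2 * n - 1"] unfolding odd[OF n] .
    show "(\<lambda>N. cumulant (P N) (Zhat N) (2 * n)) \<longlonglongrightarrow>
         bernoulli (2 * n) / real (2 * n) * (6 ^ (2 * n) / (2 ^ (2 * n) - 1))"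
      using cumulant_Zhat_tendsto[of "2 * n"] unfolding even[OF n] .
  qed (use M.prob_space_axioms distr in auto)
qed

end
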